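(* Let $\mathbf S$ be any totally ordered odd Sugihara monoid and let $\mathcal X=\{\langle X_c,\le_c\rangle : c\in S\}$ be a family of pairwise disjoint chains such that each $c\in S$ is the greatest element of $\langle X_c,\le_c\rangle$. Then $\mathbf S\otimes\mathcal X$ is a commutative idempotent residuated chain satisfying $\mathbf S=(\mathbf S\otimes\mathcal X)_{\gamma_{\mathrm e}}$ and $(S\otimes\mathcal X)_c=X_c$ for each $c\in S$. Moreover, every commutative idempotent residuated chain has this form, i.e., is equal to $\mathbf S\otimes\mathcal X$ for some totally ordered odd Sugihara monoid $\mathbf S$ and some such family $\mathcal X$.
   Context: A commutative residuated lattice is an algebra $\mathbf A=\langle A,\wedge,\vee,\cdot,\to,\mathrm e\rangle$ such that $\langle A,\wedge,\vee\rangle$ is a lattice, $\langle A,\cdot,\mathrm e\rangle$ is a commutative monoid, and $ab\le c\iff b\le a\to c$ for all $a,b,c\in A$. It is idempotent if $aa=a$ for all $a$, and a residuated chain if its lattice order is total. Write ${\sim}x:=x\to\mathrm e$. A totally ordered odd Sugihara monoid is a commutative idempotent residuated chain satisfying ${\sim}{\sim}x=x$ for all $x$. For a commutative idempotent residuated chain $\mathbf A$, let $\gamma_{\mathrm e}(x)={\sim}{\sim}x=(x\to\mathrm e)\to\mathrm e$. Let $\mathbf A_{\gamma_{\mathrm e}}$ be the algebra $\langle A_{\gamma_{\mathrm e}},\wedge,\vee_{\gamma_{\mathrm e}},\cdot_{\gamma_{\mathrm e}},\to,\gamma_{\mathrm e}(\mathrm e)\rangle$ with $A_{\gamma_{\mathrm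 e}}=\{\gamma_{\mathrm e}(b):b\in A\}$, $b\vee_{\gamma_{\mathrm e}}c=\gamma_{\mathrm e}(b\vee c)$, $b\cdot_{\gamma_{\mathrm e}}c=\gamma_{\mathrm e}(bc)$, and with $\wedge,\to$ restricted from $\mathbf A$. For $c\in A_{\gamma_{\mathrm e}}$ let $A_c=\{x\in A:\gamma_{\mathrm e}(x)=c\}$. Given $\mathbf S$ and $\mathcal X$ as in the claim, let $S\otimes\mathcal X:=\bigcup\{X_c:c\in S\}$, totally ordered by: for $x\in X_a$, $y\in X_b$ (with $a,b\in S$), $x\preceq y$ iff $a<b$, or ($a=b$ and $x\le_a y$). Let $\wedge,\vee$ be the meet and join for $\preceq$ (also written $\le$), and let $\mathbf S\otimes\mathcal X:=\langle S\otimes\mathcal X,\wedge,\vee,\cdot,\to,\mathrm e\rangle$, where $\mathrm e$ is the identity of $\mathbf S$ and for $x\in X_a$, $y\in X_b$, $$x\cdot y=\begin{cases}x\wedge y&\text{if }a=b\le\mathrm e\\ x\vee y&\text{if }\mathrm e<a=b\\ x&\text{if }a\ne b\text{ and }ab=a\\ y&\text{if }a\neq b\text{ and }ab=b\end{cases}\qquad x\to y=\begin{cases}{\sim}a\vee y&\text{if }x\preceq y\\ {\sim}a\wedge y&\text{if }y\prec x,\end{cases}$$ where $ab$, the order relation between elements of $S$, and ${\sim}a$ are computed in $\mathbf S$ (in which $ab\in\{a,b\}$ always holds). *)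

theory Defs
  imports "HOL-Algebra.Group" "HOL-Library.Disjoint_Sets"
begin

record 'a rl = "'a monoid" +
  rmeet :: "'a \<Rightarrow> 'a \<Rightarrow> 'a"
  rjoin :: "'a \<Rightarrow> 'a \<Rightarrow> 'a"
  rimp :: "'a \<Rightarrow> 'a \<Rightarrow> 'a"

definition rle :: "('a, 'm) rl_scheme \<Rightarrow> 'a \<Rightarrow> 'a \<Rightarrow> bool" where
  "rle A x y \<longleftrightarrow> rmeet A x y = x"

definition rneg :: "('a, 'm) rl_scheme \<Rightarrow> 'a \<Rightarrow> 'a" where
  "rneg A x = rimp A x (one A)"

definition gamma_e :: "('a, 'm) rl_scheme \<Rightarrow> 'a \<Rightarrow> 'a" where
  "gamma_e A x = rneg A (rneg A x)"

locale comm_residuated_lattice = comm_monoid A for A :: "('a, 'm) rl_scheme" (structure) +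
  assumes meet_closed: "\<lbrakk>x \<in> carrier A; y \<in> carrier A\<rbrakk> \<Longrightarrow> rmeet A x y \<in> carrier A"
    and join_closed: "\<lbrakk>x \<in> carrier A; y \<in> carrier A\<rbrakk> \<Longrightarrow> rjoin A x y \<in> carrier A"
    and imp_closed: "\<lbrakk>x \<in> carrier A; y \<in> carrier A\<rbrakk> \<Longrightarrow> rimp A x y \<in> carrier A"
    and meet_commute: "\<lbrakk>x \<in> carrier A; y \<in> carrier A\<rbrakk> \<Longrightarrow> rmeet A x y = rmeet A y x"
    and join_commute: "\<lbrakk>x \<in> carrier A; y \<in> carrier A\<rbrakk> \<Longrightarrow> rjoin A x y = rjoin A y x"
    and meet_assoc: "\<lbrakk>x \<in> carrier A; y \<in> carrier A; z \<in> carrier A\<rbrakk>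
      \<Longrightarrow> rmeet A (rmeet A x y) z = rmeet A x (rmeet A y z)"
    and join_assoc: "\<lbrakk>x \<in> carrier A; y \<in> carrier A; z \<in> carrier A\<rbrakk>
      \<Longrightarrow> rjoin A (rjoin A x y) z = rjoin A x (rjoin A y z)"
    and meet_join_absorb: "\<lbrakk>x \<in> carrier A; y \<in> carrier A\<rbrakk> \<Longrightarrow> rmeet A x (rjoin A x y) = x"
    and join_meet_absorb: "\<lbrakk>x \<in> carrier A; y \<in> carrier A\<rbrakk> \<Longrightarrow> rjoin A x (rmeet A x y) = x"
    and residuation: "\<lbrakk>a \<in> carrier A; b \<in> carrier A; c \<in> carrier A\<rbrakk>
      \<Longrightarrow> rle A (a \<otimes> b) c \<longleftrightarrow> rle A b (rimp A a c)"

locale comm_idem_residuated_chain = comm_residuated_lattice A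
  for A :: "('a, 'm) rl_scheme" (structure) +
  assumes idempotent: "a \<in> carrier A \<Longrightarrow> a \<otimes> a = a"
    and total: "\<lbrakk>x \<in> carrier A; y \<in> carrier A\<rbrakk> \<Longrightarrow> rle A x y \<or> rle A y x"

locale odd_sugihara_chain = comm_idem_residuated_chain A
  for A :: "('a, 'm) rl_scheme" (structure) +
  assumes involutive: "x \<in> carrier A \<Longrightarrow> rneg A (rneg A x) = x"

text \<open>HOL operations are total, so equality of algebras means equal universes and equal
  operations on the universe; values outside it are irrelevant.\<close>

definition same_algebra :: "'a rl \<Rightarrow> 'a rl \<Rightarrow> bool" where
  "same_algebra A B \<longleftrightarrow> carrier A = carrier B \<and> one A = one B \<and>
     (\<forall>x\<in>carrier A. \<forall>y\<in>carrier A.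
        rmeet A x y = rmeet B x y \<and> rjoin A x y = rjoin B x y \<and>
        mult A x y = mult B x y \<and> rimp A x y = rimp B x y)"

definition gamma_algebra :: "'a rl \<Rightarrow> 'a rl" where
  "gamma_algebra A = \<lparr>
     carrier = gamma_e A ` carrier A,
     mult = (\<lambda>b c. gamma_e A (mult A b c)),
     one = gamma_e A (one A),
     rmeet = rmeet A,
     rjoin = (\<lambda>b c. gamma_e A (rjoin A b c)),
     rimp = rimp A\<rparr>"

definition gamma_fiber :: "'a rl \<Rightarrow> 'a \<Rightarrow> 'a set" where
  "gamma_fiber A c = {x \<in> carrier A. gamma_e A x = c}"

definition chain_family :: "'a rl \<Rightarrow> ('a \<Rightarrow> 'a set) \<Rightarrow> ('a \<Rightarrow> 'a rel) \<Rightarrow> bool" where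
  "chain_family S X R \<longleftrightarrow> disjoint_family_on X (carrier S) \<and>
     (\<forall>c\<in>carrier S. linear_order_on (X c) (R c) \<and> c \<in> X c \<and> (\<forall>x\<in>X c. (x, c) \<in> R c))"

definition tensor_carrier :: "'a rl \<Rightarrow> ('a \<Rightarrow> 'a set) \<Rightarrow> 'a set" where
  "tensor_carrier S X = (\<Union>c\<in>carrier S. X c)"

text \<open>The \<open>a \<in> S\<close> with \<open>x \<in> X\<^sub>a\<close>, unique for \<open>x\<close> in the
  universe of the construction because the \<open>X\<^sub>a\<close> are pairwise disjoint.\<close>

definition tensor_index :: "'a rl \<Rightarrow> ('a \<Rightarrow> 'a set) \<Rightarrow> 'a \<Rightarrow> 'a" where
  "tensor_index S X x = (THE a. a \<in> carrier S \<and> x \<in> X a)"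

definition tensor_le :: "'a rl \<Rightarrow> ('a \<Rightarrow> 'a set) \<Rightarrow> ('a \<Rightarrow> 'a rel) \<Rightarrow> 'a \<Rightarrow> 'a \<Rightarrow> bool" where
  "tensor_le S X R x y \<longleftrightarrow>
     (let a = tensor_index S X x; b = tensor_index S X y
      in (rle S a b \<and> a \<noteq> b) \<or> (a = b \<and> (x, y) \<in> R a))"

definition tensor_meet :: "'a rl \<Rightarrow> ('a \<Rightarrow> 'a set) \<Rightarrow> ('a \<Rightarrow> 'a rel) \<Rightarrow> 'a \<Rightarrow> 'a \<Rightarrow> 'a" where
  "tensor_meet S X R x y =
     (THE z. z \<in> tensor_carrier S X \<and> tensor_le S X R z x \<and> tensor_le S X R z y \<and>
        (\<forall>w\<in>tensor_carrier S X. tensor_le S X R w x \<and> tensor_le S X R w y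
           \<longrightarrow> tensor_le S X R w z))"

definition tensor_join :: "'a rl \<Rightarrow> ('a \<Rightarrow> 'a set) \<Rightarrow> ('a \<Rightarrow> 'a rel) \<Rightarrow> 'a \<Rightarrow> 'a \<Rightarrow> 'a" where
  "tensor_join S X R x y =
     (THE z. z \<in> tensor_carrier S X \<and> tensor_le S X R x z \<and> tensor_le S X R y z \<and>
        (\<forall>w\<in>tensor_carrier S X. tensor_le S X R x w \<and> tensor_le S X R y w
           \<longrightarrow> tensor_le S X R z w))"

text \<open>In a totally ordered odd Sugihara monoid \<open>ab \<in> {a, b}\<close>, so the last branch is
  the case \<open>a \<noteq> b\<close>, \<open>ab = b\<close>.\<close>

definition tensor_mult :: "'a rl \<Rightarrow> ('a \<Rightarrow> 'a set) \<Rightarrow> ('a \<Rightarrow> 'a rel) \<Rightarrow> 'a \<Rightarrow> 'a \<Rightarrow> 'a" where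
  "tensor_mult S X R x y =
     (let a = tensor_index S X x; b = tensor_index S X y
      in if a = b then (if rle S a (one S) then tensor_meet S X R x y else tensor_join S X R x y)
         else if mult S a b = a then x else y)"

definition tensor_imp :: "'a rl \<Rightarrow> ('a \<Rightarrow> 'a set) \<Rightarrow> ('a \<Rightarrow> 'a rel) \<Rightarrow> 'a \<Rightarrow> 'a \<Rightarrow> 'a" where
  "tensor_imp S X R x y =
     (let a = tensor_index S X x
      in if tensor_le S X R x y then tensor_join S X R (rneg S a) y
         else tensor_meet S X R (rneg S a) y)"

definition tensor :: "'a rl \<Rightarrow> ('a \<Rightarrow> 'a set) \<Rightarrow> ('a \<Rightarrow> 'a rel) \<Rightarrow> 'a rl" where
  "tensor S X R = \<lparr>
     carrier = tensor_carrier S X,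
     mult = tensor_mult S X R,
     one = one S,
     rmeet = tensor_meet S X R,
     rjoin = tensor_join S X R,
     rimp = tensor_imp S X R\<rparr>"

end

theory Submission
  imports Defs
begin

text \<open>A commutative idempotent residuated chain is determined by its order and its negation:
  \<open>xy\<close> is the meet or the join of \<open>x\<close> and \<open>y\<close> according to whether
  \<open>x \<leq> \<sim>y\<close>, and \<open>x \<rightarrow> y\<close> is \<open>\<sim>x \<or> y\<close> or
  \<open>\<sim>x \<and> y\<close> according to whether \<open>x \<leq> y\<close>. Conversely, on any chain with a
  self-adjoint antitone map \<open>\<sim>\<close> fixing \<open>e\<close>, these formulas define such an algebra.
  The construction \<open>S \<otimes> X\<close> is the instance given by the lexicographic order and
  by \<open>x \<mapsto> \<sim>a\<close> for \<open>x \<in> X\<^sub>a\<close>, so that its double negation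
  sends \<open>x\<close> to \<open>a\<close>. Conversely, \<open>A\<close> carries the lexicographic order over
  its \<open>\<gamma>\<close>-fibers, because \<open>\<gamma>\<close> is monotone.\<close>

section \<open>Chains with a self-adjoint negation\<close>

locale negation_chain =
  fixes C :: "'a set" and leq :: "'a \<Rightarrow> 'a \<Rightarrow> bool" (infix "\<preceq>" 50)
    and neg :: "'a \<Rightarrow> 'a" and e :: 'a
  assumes refl: "x \<in> C \<Longrightarrow> x \<preceq> x"
    and antisym: "\<lbrakk>x \<in> C; y \<in> C; x \<preceq> y; y \<preceq> x\<rbrakk> \<Longrightarrow> x = y"
    and trans: "\<lbrakk>x \<in> C; y \<in> C; z \<in> C; x \<preceq> y; y \<preceq> z\<rbrakk> \<Longrightarrow> x \<preceq> z"
    and total: "\<lbrakk>x \<in> C; y \<in> C\<rbrakk> \<Longrightarrow> x \<preceq> y \<or> y \<preceq> x"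
    and neg_closed: "x \<in> C \<Longrightarrow> neg x \<in> C"
    and e_closed: "e \<in> C"
    and galois: "\<lbrakk>x \<in> C; y \<in> C; x \<preceq> neg y\<rbrakk> \<Longrightarrow> y \<preceq> neg x"
    and neg_e: "neg e = e"

text \<open>Giving the lattice operations by cases on the order turns the identities below into
  finite analyses of comparisons. Order and negation are parameters, so that algebras presented by
  different data can be compared.\<close>

definition presented_by ::
    "('a, 'm) rl_scheme \<Rightarrow> 'a set \<Rightarrow> ('a \<Rightarrow> 'a \<Rightarrow> bool) \<Rightarrow> ('a \<Rightarrow> 'a) \<Rightarrow> 'a \<Rightarrow> bool" where
  "presented_by A C leq neg e \<longleftrightarrow> carrier A = C \<and> one A = e \<and>
     (\<forall>x\<in>C. \<forall>y\<in>C.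
        rmeet A x y = (if leq x y then x else y) \<and>
        rjoin A x y = (if leq x y then y else x) \<and>
        mult A x y = (if leq x (neg y) then rmeet A x y else rjoin A x y) \<and>
        rimp A x y = (if leq x y then rjoin A (neg x) y else rmeet A (neg x) y))"

context negation_chain
begin

text \<open>Self-adjointness gives \<open>y \<preceq> neg (neg y)\<close>, hence
  \<open>x \<preceq> neg (neg y)\<close>; apply it once more.\<close>

lemma neg_antitone:
  assumes "x \<in> C" "y \<in> C" "x \<preceq> y"
  shows "neg y \<preceq> neg x"
  using assms galois[of y "neg y"] galois[of "neg y" y] refl neg_closed trans galois by meson

text \<open>Disjunctive form, so that the simplifier does not loop on conditional rewrite rules.\<close>

lemma order_facts:
  assumes "x \<in> C" "y \<in> C" "z \<in> C"
  shows "x \<preceq> y \<or> y \<preceq> x" "y \<preceq> z \<or> z \<preceq> y" "x \<preceq> z \<or> z \<preceq> x"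
    and "\<not> x \<preceq> y \<or> \<not> y \<preceq> x \<or> x = y" "\<not> y \<preceq> z \<or> \<not> z \<preceq> y \<or> y = z"
      "\<not> x \<preceq> z \<or> \<not> z \<preceq> x \<or> x = z"
    and "\<not> x \<preceq> y \<or> \<not> y \<preceq> z \<or> x \<preceq> z" "\<not> x \<preceq> z \<or> \<not> z \<preceq> y \<or> x \<preceq> y"
      "\<not> y \<preceq> x \<or> \<not> x \<preceq> z \<or> y \<preceq> z" "\<not> y \<preceq> z \<or> \<not> z \<preceq> x \<or> y \<preceq> x"
      "\<not> z \<preceq> x \<or> \<not> x \<preceq> y \<or> z \<preceq> y" "\<not> z \<preceq> y \<or> \<not> y \<preceq> x \<or> z \<preceq> x"
  using assms total antisym trans by blast+

text \<open>Meant for the elements closed under double negation, which inherit order and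
  negation.\<close>

lemma subchain:
  assumes "D \<subseteq> C" "e \<in> D" "\<And>x. x \<in> D \<Longrightarrow> neg x \<in> D"
  shows "negation_chain D (\<preceq>) neg e"
proof
  fix x y assume xy: "x \<in> D" "y \<in> D"
  then have C: "x \<in> C" "y \<in> C"
    using assms(1) by auto
  show "x \<preceq> y \<or> y \<preceq> x"
    by (rule total[OF C])
  show "x = y" if "x \<preceq> y" "y \<preceq> x"
    by (rule antisym[OF C that])
  show "y \<preceq> neg x" if "x \<preceq> neg y"
    by (rule galois[OF C that])
  show "x \<preceq> z" if "z \<in> D" "x \<preceq> y" "y \<preceq> z" for z
    using trans[OF C _ that(2,3)] that(1) assms(1) by auto
qed (use assms refl neg_e in auto)

context
  fixes A :: "('a, 'm) rl_scheme" (structure)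
  assumes pres: "presented_by A C (\<preceq>) neg e"
begin

lemma carrier_eq: "carrier A = C"
  and one_eq: "\<one> = e"
  and meet_eq: "\<lbrakk>x \<in> C; y \<in> C\<rbrakk> \<Longrightarrow> rmeet A x y = (if x \<preceq> y then x else y)"
  and join_eq: "\<lbrakk>x \<in> C; y \<in> C\<rbrakk> \<Longrightarrow> rjoin A x y = (if x \<preceq> y then y else x)"
  and mult_eq: "\<lbrakk>x \<in> C; y \<in> C\<rbrakk> \<Longrightarrow>
    x \<otimes> y = (if x \<preceq> neg y then rmeet A x y else rjoin A x y)"
  and imp_eq: "\<lbrakk>x \<in> C; y \<in> C\<rbrakk> \<Longrightarrow>
    rimp A x y = (if x \<preceq> y then rjoin A (neg x) y else rmeet A (neg x) y)"
  using pres unfolding presented_by_def by auto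

lemma rle_iff:
  assumes "x \<in> C" "y \<in> C"
  shows "rle A x y \<longleftrightarrow> x \<preceq> y"
  using assms refl by (auto simp: rle_def meet_eq)

text \<open>Since \<open>neg\<close> is antitone and fixes \<open>e\<close>, the elements
  \<open>neg x\<close> and \<open>e\<close> compare in the direction that makes the join or meet
  defining \<open>rimp A x e\<close> equal to \<open>neg x\<close>.\<close>

lemma rneg_eq:
  assumes x: "x \<in> C"
  shows "rneg A x = neg x"
proof -
  have "e \<preceq> neg x" if "x \<preceq> e"
    using neg_antitone[OF x e_closed that] by (simp add: neg_e)
  moreover have "neg x \<preceq> e" if "\<not> x \<preceq> e"
    using neg_antitone[OF e_closed x] total[OF x e_closed] that by (simp add: neg_e)
  ultimately show ?thesis
    using x neg_closed[OF x] e_closed antisym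
    by (auto simp: rneg_def imp_eq one_eq meet_eq join_eq)
qed

lemma product_commute:
  assumes "x \<in> C" "y \<in> C"
  shows "x \<otimes> y = y \<otimes> x"
  using assms galois[of x y] galois[of y x] antisym[of x y] total[of x y]
  by (auto simp: mult_eq meet_eq join_eq)

text \<open>The argument only uses that \<open>x \<preceq> neg y\<close> is a symmetric relation that is
  downward closed in each argument.\<close>

lemma product_assoc:
  assumes xyz: "x \<in> C" "y \<in> C" "z \<in> C"
  shows "(x \<otimes> y) \<otimes> z = x \<otimes> (y \<otimes> z)"
proof -
  have comm: "a \<preceq> neg b \<longleftrightarrow> b \<preceq> neg a" if "a \<in> C" "b \<in> C" for a b
    using galois that by blast
  have down: "\<not> a \<preceq> b \<or> \<not> b \<preceq> neg c \<or> a \<preceq> neg c"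
    if "a \<in> C" "b \<in> C" "c \<in> C" for a b c
    using trans[of a b "neg c"] neg_closed[of c] that by blast
  note facts = comm[OF xyz(1,2)] comm[OF xyz(2,3)] comm[OF xyz(1,3)]
      down[OF xyz(1,2,3)] down[OF xyz(2,1,3)] down[OF xyz(2,3,1)]
      down[OF xyz(3,2,1)] down[OF xyz(1,3,2)] down[OF xyz(3,1,2)]
      order_facts[OF xyz] xyz
  show ?thesis
    by (cases "x \<preceq> y"; cases "y \<preceq> z"; cases "x \<preceq> z"; cases "x \<preceq> neg y";
        cases "y \<preceq> neg z"; cases "x \<preceq> neg z")
      (use facts in \<open>simp_all add: mult_eq meet_eq join_eq\<close>)
qed

text \<open>If \<open>y \<preceq> neg x\<close>, the product is the meet: for
  \<open>x \<preceq> z\<close> both sides hold, otherwise both say \<open>y \<preceq> z\<close>. If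
  not, the product is the join: for \<open>x \<preceq> z\<close> both sides say
  \<open>y \<preceq> z\<close>, otherwise both fail.\<close>

lemma residuation_iff:
  assumes xyz: "x \<in> C" "y \<in> C" "z \<in> C"
  shows "rle A (x \<otimes> y) z \<longleftrightarrow> rle A y (rimp A x z)"
proof -
  have "x \<preceq> neg y \<longleftrightarrow> y \<preceq> neg x"
    using galois xyz by blast
  note facts = this xyz neg_closed[OF xyz(1)] order_facts[OF xyz]
      order_facts[OF neg_closed[OF xyz(1)] xyz(2,3)]
  show ?thesis
    by (cases "x \<preceq> y"; cases "y \<preceq> z"; cases "x \<preceq> z"; cases "x \<preceq> neg y";
        cases "neg x \<preceq> y"; cases "neg x \<preceq> z")
      (use facts in \<open>simp_all add: mult_eq meet_eq join_eq imp_eq rle_iff\<close>)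
qed

lemma comm_idem_residuated_chainI: "comm_idem_residuated_chain A"
proof
  fix x y z assume xyz: "x \<in> carrier A" "y \<in> carrier A" "z \<in> carrier A"
  note ord = order_facts[OF xyz[unfolded carrier_eq]]
  show "rmeet A (rmeet A x y) z = rmeet A x (rmeet A y z)"
    using xyz ord by (auto simp: meet_eq carrier_eq)
  show "rjoin A (rjoin A x y) z = rjoin A x (rjoin A y z)"
    using xyz ord by (auto simp: join_eq carrier_eq)
  show "(x \<otimes> y) \<otimes> z = x \<otimes> (y \<otimes> z)"
    using xyz product_assoc by (simp add: carrier_eq)
  show "rle A (x \<otimes> y) z \<longleftrightarrow> rle A y (rimp A x z)"
    using xyz residuation_iff by (simp add: carrier_eq)
next
  fix x y assume xy: "x \<in> carrier A" "y \<in> carrier A"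
  note ord = total[of x y] antisym[of x y]
  show "rmeet A x y \<in> carrier A" "rjoin A x y \<in> carrier A" "x \<otimes> y \<in> carrier A"
      "rimp A x y \<in> carrier A"
    using xy neg_closed by (auto simp: meet_eq join_eq mult_eq imp_eq carrier_eq)
  show "rmeet A x y = rmeet A y x" "rjoin A x y = rjoin A y x"
      "rmeet A x (rjoin A x y) = x" "rjoin A x (rmeet A x y) = x" "rle A x y \<or> rle A y x"
    using xy ord refl[of x] by (auto simp: meet_eq join_eq rle_iff carrier_eq)
  show "x \<otimes> y = y \<otimes> x"
    using xy product_commute by (simp add: carrier_eq)
next
  fix x assume x: "x \<in> carrier A"
  show "x \<otimes> x = x"
    using x refl by (simp add: meet_eq join_eq mult_eq carrier_eq)
  show "x \<otimes> \<one> = x"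
    using x e_closed
    by (auto simp: one_eq mult_eq meet_eq join_eq neg_e carrier_eq)
  then show "\<one> \<otimes> x = x"
    using x e_closed product_commute[of e x] by (simp add: one_eq carrier_eq)
qed (use e_closed in \<open>auto simp: one_eq carrier_eq\<close>)

end

end

text \<open>A presentation determines the algebra. Closure under negation enters because product and
  implication use the order and the lattice operations at negated elements.\<close>

lemma same_algebraI:
  assumes A: "presented_by A C leq neg e" and B: "presented_by B C leq' neg' e"
    and leq: "\<And>x y. \<lbrakk>x \<in> C; y \<in> C\<rbrakk> \<Longrightarrow> leq x y \<longleftrightarrow> leq' x y"
    and neg: "\<And>x. x \<in> C \<Longrightarrow> neg x = neg' x"
    and closed: "\<And>x. x \<in> C \<Longrightarrow> neg x \<in> C"
  shows "same_algebra A B"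
proof -
  have lattice: "rmeet A x y = rmeet B x y" "rjoin A x y = rjoin B x y"
    if "x \<in> C" "y \<in> C" for x y
    using A B leq that by (auto simp: presented_by_def)
  have "mult A x y = mult B x y" "rimp A x y = rimp B x y" if "x \<in> C" "y \<in> C" for x y
    using A B leq[of x y] leq[of x "neg y"] neg[of x] neg[of y] closed[of x] closed[of y]
      lattice[of x y] lattice[of "neg x" y] that
    by (auto simp: presented_by_def)
  then show ?thesis
    using A B lattice by (simp add: same_algebra_def presented_by_def)
qed

section \<open>Order, negation and closure in a commutative idempotent residuated chain\<close>

context comm_idem_residuated_chain
begin

lemma rle_refl:
  assumes "x \<in> carrier A"
  shows "rle A x x"
  using assms meet_join_absorb[of x "rmeet A x x"] join_meet_absorb[of x x] meet_closed[of x x]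
  by (simp add: rle_def)

lemma rle_antisym: "\<lbrakk>x \<in> carrier A; y \<in> carrier A; rle A x y; rle A y x\<rbrakk> \<Longrightarrow> x = y"
  using meet_commute by (metis rle_def)

lemma rle_trans:
  "\<lbrakk>x \<in> carrier A; y \<in> carrier A; z \<in> carrier A; rle A x y; rle A y z\<rbrakk> \<Longrightarrow> rle A x z"
  using meet_assoc by (metis rle_def)

lemma meet_cases:
  assumes xy: "x \<in> carrier A" "y \<in> carrier A"
  shows "rmeet A x y = (if rle A x y then x else y)"
proof (cases "rle A x y")
  case True
  then show ?thesis
    by (simp add: rle_def)
next
  case False
  then have "rmeet A y x = y"
    using total[OF xy] by (simp add: rle_def)
  then show ?thesis
    using False by (simp add: meet_commute[OF xy])
qed

lemma join_cases:
  assumes xy: "x \<in> carrier A" "y \<in> carrier A"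
  shows "rjoin A x y = (if rle A x y then y else x)"
proof (cases "rle A x y")
  case True
  then have "rmeet A y x = x"
    unfolding meet_commute[OF xy(2,1)] by (simp add: rle_def)
  then have "rjoin A y x = y"
    using join_meet_absorb[OF xy(2,1)] by simp
  then show ?thesis
    using True by (simp add: join_commute[OF xy])
next
  case False
  then show ?thesis
    using join_meet_absorb[OF xy] by (simp add: meet_cases[OF xy])
qed

lemma mult_mono_right:
  assumes "x \<in> carrier A" "y \<in> carrier A" "z \<in> carrier A" "rle A y z"
  shows "rle A (x \<otimes> y) (x \<otimes> z)"
proof -
  have "rle A z (rimp A x (x \<otimes> z))"
    using assms residuation[of x z "x \<otimes> z"] rle_refl by simp
  then have "rle A y (rimp A x (x \<otimes> z))"
    using assms rle_trans[of y z] imp_closed by simp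
  then show ?thesis
    using assms residuation by simp
qed

lemma rneg_closed: "x \<in> carrier A \<Longrightarrow> rneg A x \<in> carrier A"
  by (simp add: rneg_def imp_closed)

text \<open>Residuation at \<open>\<one>\<close>. The right side is symmetric in \<open>x\<close>
  and \<open>y\<close>, which makes negation self-adjoint.\<close>

lemma rle_rneg_iff:
  "\<lbrakk>x \<in> carrier A; y \<in> carrier A\<rbrakk> \<Longrightarrow> rle A x (rneg A y) \<longleftrightarrow> rle A (x \<otimes> y) \<one>"
  using residuation[of y x \<one>] by (simp add: rneg_def m_comm)

lemma rneg_one: "rneg A \<one> = \<one>"
proof (rule rle_antisym)
  show "rle A (rneg A \<one>) \<one>"
    using rle_rneg_iff[of "rneg A \<one>" \<one>] rle_refl[of "rneg A \<one>"] rneg_closed[of \<one>] by simp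
  show "rle A \<one> (rneg A \<one>)"
    using rle_rneg_iff[of \<one> \<one>] rle_refl[of \<one>] by simp
qed (simp_all add: rneg_closed)

text \<open>If \<open>x \<le> e \<le> y\<close>, then \<open>xy\<close> is comparable with \<open>e\<close>, and multiplying
  it with \<open>x\<close> or \<open>y\<close>, whichever lies on the same side of \<open>e\<close>, gives
  \<open>xy = x\<close> or \<open>xy = y\<close>.\<close>

lemma mult_of_rle:
  assumes xy: "x \<in> carrier A" "y \<in> carrier A" and le: "rle A x y"
  shows "x \<otimes> y = (if rle A (x \<otimes> y) \<one> then x else y)"
proof -
  \<comment> \<open>Idempotence and monotonicity give \<open>a = aa \<le> ab \<le> a\<close>;
    \<open>upper\<close> is the dual argument above \<open>\<one>\<close>.\<close>
  have lower: "a \<otimes> b = a" if "a \<in> carrier A" "b \<in> carrier A" "rle A a b" "rle A b \<one>" for a b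
    using that mult_mono_right[of a b \<one>] mult_mono_right[of a a b] idempotent[of a] rle_antisym
    by simp
  have upper: "a \<otimes> b = b" if "a \<in> carrier A" "b \<in> carrier A" "rle A a b" "rle A \<one> a" for a b
    using that mult_mono_right[of b \<one> a] mult_mono_right[of b a b] idempotent[of b] rle_antisym
    by (simp add: m_comm)
  consider "rle A y \<one>" | "rle A \<one> x" | "rle A x \<one>" "rle A \<one> y"
    using xy total[of x \<one>] total[of y \<one>] by auto
  then show ?thesis
  proof cases
    case 1
    then show ?thesis
      using xy le lower[of x y] rle_trans[of x y \<one>] by simp
  next
    case 2
    then have "x \<otimes> y = y"
      using xy le upper by simp
    \<comment> \<open>Here the product is \<open>y\<close>, so the first branch of the claim can
      only apply when \<open>y \<le> \<one> \<le> x \<le> y\<close>.\<close>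
    moreover have "x = y" if "rle A y \<one>"
      using xy le 2 that rle_trans[of y \<one> x] rle_antisym[of x y] by simp
    ultimately show ?thesis
      by auto
  next
    case 3
    show ?thesis
    proof (cases "rle A (x \<otimes> y) \<one>")
      case True
      have "rle A x (x \<otimes> y)"
        using xy 3 mult_mono_right[of x \<one> y] by simp
      then have "x \<otimes> (x \<otimes> y) = x"
        using xy True lower by simp
      then show ?thesis
        using xy True idempotent[of x] m_assoc[of x x y] by simp
    next
      case False
      then have "rle A \<one> (x \<otimes> y)"
        using xy total[of "x \<otimes> y" \<one>] by simp
      moreover have "rle A (x \<otimes> y) y"
        using xy 3 mult_mono_right[of y x \<one>] by (simp add: m_comm)
      ultimately have "(x \<otimes> y) \<otimes> y = y"
        using xy upper by simp
      then show ?thesis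
        using xy False idempotent[of y] m_assoc[of x y y] by simp
    qed
  qed
qed

text \<open>The condition \<open>x \<otimes> y \<le> \<one>\<close> of \<open>mult_of_rle\<close>
  becomes a comparison with a negation, so the right side no longer mentions the product.\<close>

lemma mult_cases:
  assumes xy: "x \<in> carrier A" "y \<in> carrier A"
  shows "x \<otimes> y = (if rle A x (rneg A y) then rmeet A x y else rjoin A x y)"
proof (cases "rle A x y")
  case True
  \<comment> \<open>The product occurs on both sides of \<open>mult_of_rle\<close>, so it is
    rewritten only once.\<close>
  show ?thesis
    by (subst mult_of_rle[OF xy True]) (simp add: True xy rle_rneg_iff meet_cases join_cases)
next
  case False
  then have "rle A y x"
    using total[OF xy] by simp
  from mult_of_rle[OF xy(2,1) this] have "x \<otimes> y = (if rle A (x \<otimes> y) \<one> then y else x)"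
    unfolding m_comm[OF xy(2,1)] .
  then show ?thesis
    by (rule trans) (simp add: False xy rle_rneg_iff meet_cases join_cases)
qed

sublocale negation: negation_chain "carrier A" "rle A" "rneg A" \<one>
proof
  show "rle A y (rneg A x)"
    if "x \<in> carrier A" "y \<in> carrier A" "rle A x (rneg A y)" for x y
    using that by (simp add: rle_rneg_iff m_comm)
qed (fact rle_refl rle_antisym rle_trans total rneg_closed one_closed rneg_one)+

text \<open>Residuals are unique, so the implication of \<open>A\<close> agrees with the one
  computed from order and negation.\<close>

lemma imp_cases:
  assumes xz: "x \<in> carrier A" "z \<in> carrier A"
  shows "rimp A x z = (if rle A x z then rjoin A (rneg A x) z else rmeet A (rneg A x) z)"
proof -
  \<comment> \<open>Only the implication is replaced, so \<open>B\<close> is presented by the data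
    of \<open>A\<close>, and its implication is a residual of the same product.\<close>
  define B where "B = A\<lparr>rimp := \<lambda>x y.
    if rle A x y then rjoin A (rneg A x) y else rmeet A (rneg A x) y\<rparr>"
  have B: "presented_by B (carrier A) (rle A) (rneg A) \<one>"
    by (auto simp: presented_by_def B_def meet_cases join_cases mult_cases)
  have rle_B: "rle B = rle A"
    by (simp add: fun_eq_iff rle_def B_def)
  have "rle A y (rimp A x z) \<longleftrightarrow> rle A y (rimp B x z)" if "y \<in> carrier A" for y
    using negation.residuation_iff[OF B, of x y z] residuation[of x y z] xz that
    by (simp add: rle_B) (simp add: B_def)
  moreover have "rimp A x z \<in> carrier A" "rimp B x z \<in> carrier A"
    using xz by (auto simp: B_def imp_closed join_closed meet_closed rneg_closed)
  \<comment> \<open>Taking \<open>y\<close> to be each of the two implications gives both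
    inequalities.\<close>
  ultimately have "rimp A x z = rimp B x z"
    using rle_antisym rle_refl by metis
  then show ?thesis
    by (simp add: B_def)
qed

lemma presented: "presented_by A (carrier A) (rle A) (rneg A) \<one>"
  by (simp add: presented_by_def meet_cases join_cases mult_cases imp_cases)

lemma gamma_closed: "x \<in> carrier A \<Longrightarrow> gamma_e A x \<in> carrier A"
  by (simp add: gamma_e_def rneg_closed)

lemma gamma_one: "gamma_e A \<one> = \<one>"
  by (simp add: gamma_e_def rneg_one)

lemma gamma_increasing: "x \<in> carrier A \<Longrightarrow> rle A x (gamma_e A x)"
  using negation.galois[of "rneg A x" x] rle_refl rneg_closed by (simp add: gamma_e_def)

lemma gamma_mono:
  "\<lbrakk>x \<in> carrier A; y \<in> carrier A; rle A x y\<rbrakk> \<Longrightarrow> rle A (gamma_e A x) (gamma_e A y)"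
  using negation.neg_antitone rneg_closed by (simp add: gamma_e_def)

text \<open>The triple negation law of a Galois connection: negate
  \<open>x \<le> \<gamma>(x)\<close>, and apply the same inequality to the negation of
  \<open>x\<close>.\<close>

lemma rneg_gamma:
  assumes x: "x \<in> carrier A"
  shows "rneg A (gamma_e A x) = rneg A x"
proof -
  have "rle A (rneg A (gamma_e A x)) (rneg A x)"
    using x negation.neg_antitone gamma_increasing gamma_closed by simp
  moreover have "rle A (rneg A x) (rneg A (gamma_e A x))"
    using x gamma_increasing[of "rneg A x"] rneg_closed by (simp add: gamma_e_def)
  ultimately show ?thesis
    using x rle_antisym rneg_closed gamma_closed by simp
qed

lemma gamma_rneg: "x \<in> carrier A \<Longrightarrow> gamma_e A (rneg A x) = rneg A x"
  using rneg_gamma by (simp add: gamma_e_def)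

lemma gamma_idem: "x \<in> carrier A \<Longrightarrow> gamma_e A (gamma_e A x) = gamma_e A x"
  using rneg_gamma by (simp add: gamma_e_def)

end

section \<open>The algebra of closed elements\<close>

context
  fixes A :: "'a rl" (structure)
  assumes chain: "comm_idem_residuated_chain A"
begin

interpretation comm_idem_residuated_chain A
  by (fact chain)

text \<open>In a chain, joins and products of two closed elements are again one of the two, and
  negations are closed. Hence the closure applied after join and product changes nothing, and the
  operations are those of \<open>A\<close> restricted.\<close>

lemma gamma_presented:
  "presented_by (gamma_algebra A) (gamma_e A ` carrier A) (rle A) (rneg A) \<one>"
proof -
  have fixed: "gamma_e A x = x" if "x \<in> gamma_e A ` carrier A" for x
    using that gamma_idem by auto
  have closed: "x \<in> carrier A" if "x \<in> gamma_e A ` carrier A" for x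
    using that gamma_closed by auto
  have "rmeet A x y = (if rle A x y then x else y) \<and>
      gamma_e A (rjoin A x y) = (if rle A x y then y else x) \<and>
      gamma_e A (x \<otimes> y) = (if rle A x (rneg A y) then rmeet A x y else gamma_e A (rjoin A x y)) \<and>
      rimp A x y =
        (if rle A x y then gamma_e A (rjoin A (rneg A x) y) else rmeet A (rneg A x) y)"
    if xy: "x \<in> gamma_e A ` carrier A" "y \<in> gamma_e A ` carrier A" for x y
  proof -
    note in_A = closed[OF xy(1)] closed[OF xy(2)] rneg_closed[OF closed[OF xy(1)]]
    show ?thesis
      using in_A fixed[OF xy(1)] fixed[OF xy(2)] gamma_rneg[OF in_A(1)]
      by (simp add: meet_cases join_cases mult_cases imp_cases)
  qed
  then show ?thesis
    by (simp add: presented_by_def gamma_algebra_def gamma_one)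
qed

text \<open>All negations and \<open>\<one>\<close> are closed, so the closed elements form a
  subchain with the same negation, and double negation fixes each of them.\<close>

lemma odd_sugihara_chain_gamma: "odd_sugihara_chain (gamma_algebra A)"
proof -
  let ?G = "gamma_e A ` carrier A"
  have sub: "?G \<subseteq> carrier A"
    using gamma_closed by auto
  have neg: "rneg A x \<in> ?G" if "x \<in> carrier A" for x
    using gamma_rneg[OF that] rneg_closed[OF that] by (metis imageI)
  have one: "\<one> \<in> ?G"
    using gamma_one one_closed by (metis imageI)
  interpret G: negation_chain ?G "rle A" "rneg A" \<one>
    by (rule negation.subchain[OF sub one]) (use sub neg in blast)
  interpret S: comm_idem_residuated_chain "gamma_algebra A"
    by (rule G.comm_idem_residuated_chainI[OF gamma_presented])
  show ?thesis
  proof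
    fix x assume "x \<in> carrier (gamma_algebra A)"
    then have x: "x \<in> ?G"
      by (simp add: gamma_algebra_def)
    then obtain b where "b \<in> carrier A" "x = gamma_e A b"
      by blast
    then have "rneg A (rneg A x) = x"
      using gamma_idem[of b] by (simp add: gamma_e_def)
    then show "rneg (gamma_algebra A) (rneg (gamma_algebra A) x) = x"
      using x G.neg_closed by (simp add: G.rneg_eq[OF gamma_presented])
  qed
qed

end

section \<open>The lexicographic construction over an odd Sugihara chain\<close>

locale tensor_data = odd_sugihara_chain S
  for S :: "'a rl" (structure) and X :: "'a \<Rightarrow> 'a set" and R :: "'a \<Rightarrow> 'a rel" +
  assumes family: "chain_family S X R"
begin

abbreviation T :: "'a set" where "T \<equiv> tensor_carrier S X"
abbreviation idx :: "'a \<Rightarrow> 'a" where "idx \<equiv> tensor_index S X"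
abbreviation tle :: "'a \<Rightarrow> 'a \<Rightarrow> bool" (infix "\<preceq>" 50) where "x \<preceq> y \<equiv> tensor_le S X R x y"

lemma idx_eq:
  assumes "c \<in> carrier S" "x \<in> X c"
  shows "idx x = c"
  unfolding tensor_index_def
proof (rule the_equality)
  show "a = c" if "a \<in> carrier S \<and> x \<in> X a" for a
    using that assms family by (auto simp: chain_family_def disjoint_family_on_def)
qed (use assms in blast)

lemma idx_closed:
  assumes "x \<in> T"
  shows "idx x \<in> carrier S" "x \<in> X (idx x)"
  using assms idx_eq by (auto simp: tensor_carrier_def)

lemma carrier_subset: "c \<in> carrier S \<Longrightarrow> c \<in> T"
  using family by (auto simp: chain_family_def tensor_carrier_def)

lemma idx_of_carrier: "c \<in> carrier S \<Longrightarrow> idx c = c"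
  using family idx_eq by (auto simp: chain_family_def)

lemma fiber_order:
  assumes "c \<in> carrier S"
  shows "linear_order_on (X c) (R c)"
  using assms family by (simp add: chain_family_def)

lemma tle_iff: "x \<preceq> y \<longleftrightarrow> rle S (idx x) (idx y) \<and> idx x \<noteq> idx y \<or> idx x = idx y \<and> (x, y) \<in> R (idx x)"
  by (simp add: tensor_le_def Let_def)

text \<open>As \<open>c\<close> is the top of its own fiber, a tie of indices is always decided in
  its favor. This reduces comparisons with negations, which lie in \<open>S\<close>, to
  \<open>S\<close>.\<close>

lemma tle_top_iff:
  assumes x: "x \<in> T" and c: "c \<in> carrier S"
  shows "x \<preceq> c \<longleftrightarrow> rle S (idx x) c"
  using family idx_closed[OF x] c rle_refl[OF c]
  by (auto simp: tle_iff idx_of_carrier chain_family_def)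

lemma tle_refl:
  assumes "x \<in> T"
  shows "x \<preceq> x"
  using idx_closed[OF assms] fiber_order
  by (auto simp: tle_iff order_on_defs refl_on_def)

lemma tle_antisym:
  assumes "x \<in> T" "y \<in> T" "x \<preceq> y" "y \<preceq> x"
  shows "x = y"
proof -
  have eq: "idx x = idx y"
    using assms rle_antisym idx_closed(1) unfolding tle_iff by metis
  have "Relation.antisym (R (idx x))"
    using fiber_order[OF idx_closed(1)[OF assms(1)]] by (simp add: order_on_defs)
  moreover have "(x, y) \<in> R (idx x)" "(y, x) \<in> R (idx x)"
    using assms(3,4) eq by (simp_all add: tle_iff)
  ultimately show ?thesis
    by (rule antisymD)
qed

lemma tle_trans:
  assumes "x \<in> T" "y \<in> T" "z \<in> T" "x \<preceq> y" "y \<preceq> z"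
  shows "x \<preceq> z"
proof -
  note idx = idx_closed(1)[OF assms(1)] idx_closed(1)[OF assms(2)] idx_closed(1)[OF assms(3)]
  have "trans (R (idx x))"
    using fiber_order[OF idx(1)] by (simp add: order_on_defs)
  \<comment> \<open>Antisymmetry in \<open>S\<close> excludes
    \<open>idx x < idx y \<le> idx z = idx x\<close>.\<close>
  then show ?thesis
    using assms(4,5) rle_trans[OF idx] rle_antisym[OF idx(1,2)]
    unfolding tle_iff by (metis transD)
qed

lemma tle_total:
  assumes "x \<in> T" "y \<in> T"
  shows "x \<preceq> y \<or> y \<preceq> x"
proof (cases "idx x = idx y")
  case True
  then have "(x, y) \<in> R (idx x) \<or> (y, x) \<in> R (idx x)"
    using assms idx_closed fiber_order[of "idx x"]
    unfolding order_on_defs refl_on_def total_on_def by metis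
  then show ?thesis
    using True by (simp add: tle_iff)
next
  case False
  then show ?thesis
    using total[of "idx x" "idx y"] assms idx_closed by (auto simp: tle_iff)
qed

abbreviation tneg :: "'a \<Rightarrow> 'a" where "tneg x \<equiv> rneg S (idx x)"

sublocale lex: negation_chain T "(\<preceq>)" tneg \<one>
proof
  \<comment> \<open>Both comparisons are with elements of \<open>S\<close>, so self-adjointness is
    inherited from \<open>S\<close> through the indices.\<close>
  show "y \<preceq> tneg x" if "x \<in> T" "y \<in> T" "x \<preceq> tneg y" for x y
    using that idx_closed rneg_closed negation.galois by (simp add: tle_top_iff)
  show "tneg x \<in> T" if "x \<in> T" for x
    using that by (simp add: carrier_subset rneg_closed idx_closed)
  show "\<one> \<in> T" "tneg \<one> = \<one>"
    by (simp_all add: carrier_subset idx_of_carrier rneg_one)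
qed (fact tle_refl tle_antisym tle_trans tle_total)+

lemma tensor_meet_eq:
  assumes "x \<in> T" "y \<in> T"
  shows "tensor_meet S X R x y = (if x \<preceq> y then x else y)"
  unfolding tensor_meet_def
  by (rule the_equality) (use assms tle_refl tle_total[OF assms] in \<open>auto intro: tle_antisym split: if_splits\<close>)

lemma tensor_join_eq:
  assumes "x \<in> T" "y \<in> T"
  shows "tensor_join S X R x y = (if x \<preceq> y then y else x)"
  unfolding tensor_join_def
  by (rule the_equality) (use assms tle_refl tle_total[OF assms] in \<open>auto intro: tle_antisym split: if_splits\<close>)

text \<open>Within one fiber of index \<open>a\<close>, idempotence turns
  \<open>a \<le> \<sim>a\<close> into \<open>a \<le> \<one>\<close>, the condition in the
  definition. For distinct indices the order is that of the indices, and the product in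
  \<open>S\<close> selects their meet or join by the same test.\<close>

lemma tensor_mult_eq:
  assumes xy: "x \<in> T" "y \<in> T"
  shows "tensor_mult S X R x y =
    (if x \<preceq> tneg y then tensor_meet S X R x y else tensor_join S X R x y)"
proof -
  note idx = idx_closed(1)[OF xy(1)] idx_closed(1)[OF xy(2)]
  have top: "x \<preceq> tneg y \<longleftrightarrow> rle S (idx x) (tneg y)"
    using xy idx rneg_closed by (simp add: tle_top_iff)
  show ?thesis
  proof (cases "idx x = idx y")
    case True
    then show ?thesis
      using idx rle_rneg_iff[OF idx] idempotent[OF idx(2)] by (simp add: tensor_mult_def top)
  next
    case False
    then have "x \<preceq> y \<longleftrightarrow> rle S (idx x) (idx y)"
      by (simp add: tle_iff)
    then show ?thesis
      using False xy
      by (auto simp: tensor_mult_def Let_def top mult_cases[OF idx] meet_cases[OF idx]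
          join_cases[OF idx] tensor_meet_eq tensor_join_eq)
  qed
qed

lemma tensor_presented: "presented_by (tensor S X R) T (\<preceq>) tneg \<one>"
  by (simp add: presented_by_def tensor_def tensor_meet_eq tensor_join_eq tensor_mult_eq
      tensor_imp_def Let_def)

lemmas tensor_chain = lex.comm_idem_residuated_chainI[OF tensor_presented]

text \<open>The first negation already lands in \<open>S\<close>, where each element is its own
  index; the second one then gives \<open>\<sim>\<sim>(idx x)\<close>, and \<open>S\<close> is
  involutive.\<close>

lemma gamma_tensor:
  assumes x: "x \<in> T"
  shows "gamma_e (tensor S X R) x = idx x"
  using x idx_closed[OF x] rneg_closed lex.neg_closed involutive
  by (simp add: gamma_e_def lex.rneg_eq[OF tensor_presented] idx_of_carrier)

lemma gamma_fiber_tensor: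
  assumes "c \<in> carrier S"
  shows "gamma_fiber (tensor S X R) c = X c"
proof -
  have "gamma_fiber (tensor S X R) c = {x \<in> T. idx x = c}"
    using gamma_tensor by (auto simp: gamma_fiber_def tensor_def)
  also have "\<dots> = X c"
    using assms idx_closed idx_eq by (auto simp: tensor_carrier_def)
  finally show ?thesis .
qed

text \<open>Double negation maps onto \<open>S\<close>, and on \<open>S\<close> the lexicographic
  order and its negation restrict to the original ones, so the two presentations agree.\<close>

lemma same_algebra_gamma_tensor: "same_algebra S (gamma_algebra (tensor S X R))"
proof (rule same_algebraI[OF presented])
  have "gamma_e (tensor S X R) ` carrier (tensor S X R) = idx ` T"
    using gamma_tensor by (auto simp: tensor_def)
  also have "\<dots> = carrier S"
    using idx_closed carrier_subset idx_of_carrier by force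
  finally show "presented_by (gamma_algebra (tensor S X R)) (carrier S)
      (rle (tensor S X R)) (rneg (tensor S X R)) \<one>"
    using gamma_presented[OF tensor_chain] by (simp add: tensor_def)
  show "rle S x y \<longleftrightarrow> rle (tensor S X R) x y" if "x \<in> carrier S" "y \<in> carrier S" for x y
    using that carrier_subset
    by (simp add: lex.rle_iff[OF tensor_presented] tle_top_iff idx_of_carrier)
  show "rneg S x = rneg (tensor S X R) x" if "x \<in> carrier S" for x
    using that carrier_subset by (simp add: lex.rneg_eq[OF tensor_presented] idx_of_carrier)
qed (rule rneg_closed)

end

section \<open>Decomposition of an arbitrary chain into its fibers\<close>

context
  fixes A :: "'a rl" (structure)
  assumes chain: "comm_idem_residuated_chain A"
begin

interpretation comm_idem_residuated_chain A
  by (fact chain)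

text \<open>Restricted to the fiber, since \<open>linear_order_on\<close> asks for a relation
  contained in the square of its set.\<close>

definition fiber_rel :: "'a \<Rightarrow> 'a rel" where
  "fiber_rel c = {(x, y). x \<in> gamma_fiber A c \<and> y \<in> gamma_fiber A c \<and> rle A x y}"

lemma carrier_gamma_algebra: "carrier (gamma_algebra A) = gamma_e A ` carrier A"
  by (simp add: gamma_algebra_def)

text \<open>Fibers of a map are disjoint; \<open>c\<close> tops its fiber because
  \<open>x \<le> \<gamma>(x) = c\<close> there, and lies in it by idempotence of
  \<open>\<gamma>\<close>.\<close>

lemma chain_family_gamma: "chain_family (gamma_algebra A) (gamma_fiber A) fiber_rel"
  unfolding chain_family_def
proof (intro conjI ballI)
  show "disjoint_family_on (gamma_fiber A) (carrier (gamma_algebra A))"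
    by (auto simp: disjoint_family_on_def gamma_fiber_def)
next
  fix c assume c: "c \<in> carrier (gamma_algebra A)"
  show "linear_order_on (gamma_fiber A c) (fiber_rel c)"
    unfolding order_on_defs
  proof (intro conjI)
    show "fiber_rel c \<subseteq> gamma_fiber A c \<times> gamma_fiber A c"
      by (auto simp: fiber_rel_def)
    show "refl_on (gamma_fiber A c) (fiber_rel c)"
      by (auto simp: refl_on_def fiber_rel_def gamma_fiber_def rle_refl)
    show "Relation.trans (fiber_rel c)"
      by (rule transI) (auto simp: fiber_rel_def gamma_fiber_def intro: rle_trans)
    show "Relation.antisym (fiber_rel c)"
      by (rule antisymI) (auto simp: fiber_rel_def gamma_fiber_def intro: rle_antisym)
    show "total_on (gamma_fiber A c) (fiber_rel c)"
      using total by (auto simp: total_on_def fiber_rel_def gamma_fiber_def)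
  qed
  show c_fiber: "c \<in> gamma_fiber A c"
    using c by (auto simp: carrier_gamma_algebra gamma_fiber_def gamma_idem gamma_closed)
  show "(x, c) \<in> fiber_rel c" if "x \<in> gamma_fiber A c" for x
    using that c_fiber gamma_increasing by (auto simp: fiber_rel_def gamma_fiber_def)
qed

text \<open>Both algebras have presentations, so it suffices to match order and negation. The index
  of \<open>x\<close> is \<open>\<gamma>(x)\<close>, and \<open>x\<close> and
  \<open>\<gamma>(x)\<close> have the same negation.\<close>

lemma same_algebra_tensor:
  "same_algebra A (tensor (gamma_algebra A) (gamma_fiber A) fiber_rel)"
proof -
  let ?S = "gamma_algebra A"
  interpret D: tensor_data ?S "gamma_fiber A" fiber_rel
    using odd_sugihara_chain_gamma[OF chain] chain_family_gamma
    by (intro tensor_data.intro tensor_data_axioms.intro)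
  have T: "D.T = carrier A"
    by (auto simp: tensor_carrier_def carrier_gamma_algebra gamma_fiber_def)
  have idx: "D.idx x = gamma_e A x" if "x \<in> carrier A" for x
    using that by (intro D.idx_eq) (auto simp: carrier_gamma_algebra gamma_fiber_def)
  have le: "rle ?S x y \<longleftrightarrow> rle A x y" for x y
    by (simp add: rle_def gamma_algebra_def)
  have neg: "rneg ?S x = rneg A x" for x
    by (simp add: rneg_def gamma_algebra_def gamma_one)
  \<comment> \<open>If the closures differ, totality and monotonicity of \<open>\<gamma>\<close>
    force \<open>x\<close> and \<open>y\<close> to compare as their closures do; if they agree,
    \<open>fiber_rel\<close> is the order of \<open>A\<close>.\<close>
  have "rle A x y \<longleftrightarrow> D.tle x y" if xy: "x \<in> carrier A" "y \<in> carrier A" for x y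
    using xy gamma_mono[OF xy] gamma_mono[OF xy(2,1)] total[OF xy]
      rle_antisym[OF gamma_closed[OF xy(1)] gamma_closed[OF xy(2)]]
    by (auto simp: D.tle_iff le idx fiber_rel_def gamma_fiber_def)
  moreover have "rneg A x = D.tneg x" if "x \<in> carrier A" for x
    using that by (simp add: idx neg rneg_gamma)
  moreover have "one ?S = \<one>"
    by (simp add: gamma_algebra_def gamma_one)
  ultimately show ?thesis
    using D.tensor_presented rneg_closed by (intro same_algebraI[OF presented]) (simp_all add: T)
qed

end

theorem theorem3p5:
  shows "(\<forall>(S :: 'a rl) X R. odd_sugihara_chain S \<and> chain_family S X R \<longrightarrow>
            comm_idem_residuated_chain (tensor S X R) \<and>
            same_algebra S (gamma_algebra (tensor S X R)) \<and>
            (\<forall>c\<in>carrier S. gamma_fiber (tensor S X R) c = X c))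
       \<and> (\<forall>A :: 'a rl. comm_idem_residuated_chain A \<longrightarrow>
            (\<exists>S X R. odd_sugihara_chain S \<and> chain_family S X R \<and> same_algebra A (tensor S X R)))"
proof (intro conjI allI impI)
  fix S :: "'a rl" and X R assume "odd_sugihara_chain S \<and> chain_family S X R"
  then interpret tensor_data S X R
    by (simp add: tensor_data_def tensor_data_axioms_def)
  show "comm_idem_residuated_chain (tensor S X R)"
    by (rule tensor_chain)
  show "same_algebra S (gamma_algebra (tensor S X R))"
    by (rule same_algebra_gamma_tensor)
  show "\<forall>c\<in>carrier S. gamma_fiber (tensor S X R) c = X c"
    using gamma_fiber_tensor by blast
next
  fix A :: "'a rl" assume "comm_idem_residuated_chain A"
  \<comment> \<open>The witnesses are \<open>gamma_algebra A\<close>, the fibers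
    \<open>gamma_fiber A\<close> and the order of \<open>A\<close> restricted to each fiber.\<close>
  then show "\<exists>S X R. odd_sugihara_chain S \<and> chain_family S X R \<and> same_algebra A (tensor S X R)"
    using odd_sugihara_chain_gamma chain_family_gamma same_algebra_tensor by blast
qed

end
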